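(* Let $0\in\mathbb{R}^n$ be globally asymptotically stable (GAS) under two dynamical systems $\dot x=F_0(x)$ and $\dot x=F_1(x)$, with $F_0,F_1\in C^0(\mathbb{R}^n;\mathbb{R}^n)$ complete vector fields giving rise to the flows $\varphi_0$ and $\varphi_1$. Assume that $0$ being GAS is asserted by (possibly different) smooth ($C^\infty$), convex Lyapunov functions $V_0$ and $V_1$, respectively. Then $0$ (with respect to $\varphi_0$) and $0$ (with respect to $\varphi_1$) are related by continuation, where the isolating neighbourhood $N$ can be chosen to be of the form $N=N_0\cap N_1$ with $N_i=\{x\in\mathbb{R}^n:V_i(x)\leq c_i\}$, $c_i>0$, a sub-level set of $V_i$ for $i=0,1$.
   Context: A continuous vector field $F$ on $\mathbb{R}^n$ is complete if it induces a continuous global flow $\varphi:\mathbb{R}\times\mathbb{R}^n\to\mathbb{R}^n$. The point $0$ (with $F(0)=0$) is GAS under $F$ if it is Lyapunov stable (for every open neighbourhood $U_\varepsilon$ of $0$ there is an open neighbourhood $U_\delta\subseteq U_\varepsilon$ of $0$ such that solutions starting in $U_\delta$ stay in $U_\varepsilon$ for all forward times) and $\lim_{t\to+\infty}\varphi^t(x_0)=0$ for all $x_0\in\mathbb{R}^n$. $V\in C^{\infty}(\mathbb{R}^n;\mathbb{R}_{\geq 0})$ is a Lyapunov function with respect to $F$ and $0$ if (a) $V(0)=0$ and $V(x)>0$ for all $x\neq 0$; (b) $\langle\nabla V(x),F(x)\rangle<0$ for all $x\neq 0$; (c) $V(x)\to+\infty$ as $\|x\|\to+\infty$. For a compact set $N\subset\mathbb{R}^n$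 and a continuous vector field $G$, let $\mathrm{Inv}(N,G)$ be the set of $x\in N$ through which there passes a solution of $\dot x=G(x)$ defined on all of $\mathbb{R}$ with image contained in $N$; if $G$ induces a flow $\varphi$ this is $\{x\in N:\varphi(\mathbb{R},x)\subseteq N\}$. $N$ is an isolating neighbourhood for $G$ if $\mathrm{Inv}(N,G)\subseteq\mathrm{int}(N)$. That $0$ (with respect to $\varphi_0$) and $0$ (with respect to $\varphi_1$) are related by continuation with isolating neighbourhood $N$ means: there is a continuous map $H:[0,1]\times\mathbb{R}^n\to\mathbb{R}^n$ with $H(0,\cdot)=F_0$ and $H(1,\cdot)=F_1$ such that the compact set $N$ is an isolating neighbourhood for $H(\lambda,\cdot)$ for every $\lambda\in[0,1]$, and $\mathrm{Inv}(N,F_0)=\mathrm{Inv}(N,F_1)=\{0\}$. *)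

theory Defs
  imports "HOL-Analysis.Analysis"
begin

definition is_solution :: "('a::real_normed_vector \<Rightarrow> 'a) \<Rightarrow> real set \<Rightarrow> (real \<Rightarrow> 'a) \<Rightarrow> bool" where
  "is_solution G T u \<longleftrightarrow> (\<forall>t\<in>T. (u has_vector_derivative G (u t)) (at t within T))"

definition global_flow :: "(real \<Rightarrow> 'a::topological_space \<Rightarrow> 'a) \<Rightarrow> bool" where
  "global_flow \<phi> \<longleftrightarrow>
     continuous_on UNIV (\<lambda>(t, x). \<phi> t x) \<and>
     (\<forall>x. \<phi> 0 x = x) \<and>
     (\<forall>s t x. \<phi> (s + t) x = \<phi> s (\<phi> t x))"

text \<open>
  A merely continuous vector field may have non-unique solutions. Uniqueness is not required
  here: only that every orbit of the flow is a solution.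
\<close>
definition induces_flow ::
    "('a::real_normed_vector \<Rightarrow> 'a) \<Rightarrow> (real \<Rightarrow> 'a \<Rightarrow> 'a) \<Rightarrow> bool" where
  "induces_flow G \<phi> \<longleftrightarrow> global_flow \<phi> \<and> (\<forall>x. is_solution G UNIV (\<lambda>t. \<phi> t x))"

definition lyapunov_stable :: "('a::real_normed_vector \<Rightarrow> 'a) \<Rightarrow> bool" where
  "lyapunov_stable G \<longleftrightarrow>
     (\<forall>U. open U \<and> 0 \<in> U \<longrightarrow>
       (\<exists>W. open W \<and> 0 \<in> W \<and> W \<subseteq> U \<and>
         (\<forall>u. is_solution G {0..} u \<and> u 0 \<in> W \<longrightarrow> (\<forall>t\<ge>0. u t \<in> U))))"

definition GAS :: "('a::real_normed_vector \<Rightarrow> 'a) \<Rightarrow> (real \<Rightarrow> 'a \<Rightarrow> 'a) \<Rightarrow> bool" where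
  "GAS G \<phi> \<longleftrightarrow>
     G 0 = 0 \<and> lyapunov_stable G \<and> (\<forall>x. ((\<lambda>t. \<phi> t x) \<longlongrightarrow> 0) at_top)"

text \<open>\<open>C_diff k f\<close>: all iterated partial derivatives of \<open>f\<close> of order at most \<open>k\<close> exist and
  are continuous.\<close>
fun C_diff :: "nat \<Rightarrow> ('a::euclidean_space \<Rightarrow> real) \<Rightarrow> bool" where
  "C_diff 0 f \<longleftrightarrow> continuous_on UNIV f"
| "C_diff (Suc k) f \<longleftrightarrow>
     f differentiable_on UNIV \<and>
     (\<forall>b\<in>Basis. C_diff k (\<lambda>x. frechet_derivative f (at x) b))"

definition smooth :: "('a::euclidean_space \<Rightarrow> real) \<Rightarrow> bool" where
  "smooth f \<longleftrightarrow> (\<forall>k. C_diff k f)"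

definition gradient :: "('a::real_inner \<Rightarrow> real) \<Rightarrow> 'a \<Rightarrow> 'a" where
  "gradient f x = (THE g. GDERIV f x :> g)"

definition lyapunov_function ::
    "('a::euclidean_space \<Rightarrow> real) \<Rightarrow> ('a \<Rightarrow> 'a) \<Rightarrow> bool" where
  "lyapunov_function V G \<longleftrightarrow>
     smooth V \<and>
     V 0 = 0 \<and> (\<forall>x. x \<noteq> 0 \<longrightarrow> V x > 0) \<and>
     (\<forall>x. x \<noteq> 0 \<longrightarrow> gradient V x \<bullet> G x < 0) \<and>
     filterlim V at_top at_infinity"

definition Inv :: "'a::real_normed_vector set \<Rightarrow> ('a \<Rightarrow> 'a) \<Rightarrow> 'a set" where
  "Inv N G = {x \<in> N. \<exists>u. is_solution G UNIV u \<and> x \<in> range u \<and> range u \<subseteq> N}"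

definition isolating_neighbourhood ::
    "'a::real_normed_vector set \<Rightarrow> ('a \<Rightarrow> 'a) \<Rightarrow> bool" where
  "isolating_neighbourhood N G \<longleftrightarrow> compact N \<and> Inv N G \<subseteq> interior N"

definition related_by_continuation ::
    "('a::real_normed_vector \<Rightarrow> 'a) \<Rightarrow> ('a \<Rightarrow> 'a) \<Rightarrow> 'a set \<Rightarrow> bool" where
  "related_by_continuation F0 F1 N \<longleftrightarrow>
     (\<exists>H :: real \<Rightarrow> 'a \<Rightarrow> 'a.
        continuous_on ({0..1} \<times> UNIV) (\<lambda>(s, x). H s x) \<and>
        H 0 = F0 \<and> H 1 = F1 \<and>
        (\<forall>s\<in>{0..1}. isolating_neighbourhood N (H s))) \<and>
     Inv N F0 = {0} \<and> Inv N F1 = {0}"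

end

(* By convexity, <grad V_i(x), -x> \<le> V_i(0) - V_i(x) < 0 for x \<noteq> 0, so V_i is also a strict Lyapunov
   function for the field -x, hence for every convex combination of F_i and -x. Moving along
   straight lines from F_0 to -x and then from -x to F_1, each field of the homotopy has V_0 or V_1
   as strict Lyapunov function. Such a field has no complete orbit other than 0 in a compact set:
   backwards in time V would grow at least linearly along it. *)
theory Submission
  imports Defs
begin

text \<open>\<open>gradient\<close> is a definite description and says nothing until a unique
  representing vector is exhibited. The vector \<open>g\<close> of partial derivatives represents
  the linear map \<open>?D\<close>, and uniqueness of the derivative excludes any other.\<close>

lemma gradient_inner_eq_frechet_derivative:
  fixes f :: "'a::euclidean_space \<Rightarrow> real"
  assumes "f differentiable (at x)"
  shows "gradient f x \<bullet> h = frechet_derivative f (at x) h"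
proof -
  let ?D = "frechet_derivative f (at x)"
  define g where "g = (\<Sum>b\<in>Basis. ?D b *\<^sub>R b)"
  have D: "(f has_derivative ?D) (at x)"
    using assms frechet_derivative_works by blast
  then have "linear ?D"
    by (rule has_derivative_linear)
  have inner_g: "?D h = h \<bullet> g" for h
  proof -
    have "?D h = ?D (\<Sum>b\<in>Basis. (h \<bullet> b) *\<^sub>R b)"
      by (simp add: euclidean_representation)
    also have "\<dots> = (\<Sum>b\<in>Basis. (h \<bullet> b) * ?D b)"
      using \<open>linear ?D\<close> by (simp add: linear_sum linear_scale)
    also have "\<dots> = h \<bullet> g"
      by (simp add: g_def inner_sum_right mult.commute)
    finally show ?thesis .
  qed
  then have "?D = (\<lambda>h. h \<bullet> g)"
    by (rule ext)
  with D have deriv: "(f has_derivative (\<lambda>h. h \<bullet> g)) (at x)"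
    by simp
  then have "g' = g" if "(f has_derivative (\<lambda>h. h \<bullet> g')) (at x)" for g'
    using has_derivative_unique[OF that deriv] vector_eq_ldot[of g' g] by meson
  with deriv have "gradient f x = g"
    unfolding gradient_def gderiv_def by (rule the_equality)
  then show ?thesis
    by (simp add: inner_g inner_commute)
qed

lemma continuous_on_gradient:
  fixes f :: "'a::euclidean_space \<Rightarrow> real"
  assumes "C_diff 1 f"
  shows "continuous_on UNIV (gradient f)"
proof -
  have "f differentiable (at x)" for x
    using assms by (simp add: differentiable_on_def)
  then have "gradient f x \<bullet> b = frechet_derivative f (at x) b" for x b
    by (rule gradient_inner_eq_frechet_derivative)
  then show ?thesis
    using assms by (simp add: continuous_on_componentwise[of UNIV "gradient f"])
qed

text \<open>Convexity bounds each difference quotient along the segment from \<open>x\<close> to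
  \<open>y\<close> by \<open>f y - f x\<close>. The bound survives the limit at \<open>x\<close>
  from the right, which is the directional derivative.\<close>

lemma convex_on_gradient_ineq:
  fixes f :: "'a::euclidean_space \<Rightarrow> real"
  assumes "convex_on UNIV f" and diff: "f differentiable (at x)"
  shows "gradient f x \<bullet> (y - x) \<le> f y - f x"
proof -
  let ?p = "\<lambda>t::real. x + t *\<^sub>R (y - x)"
  have "(f has_derivative frechet_derivative f (at x)) (at x)"
    using diff frechet_derivative_works by blast
  then have "(f has_derivative frechet_derivative f (at x)) (at (?p 0))"
    by simp
  moreover have "(?p has_vector_derivative (y - x)) (at 0)"
    by (auto intro!: derivative_eq_intros)
  ultimately have "((\<lambda>t. f (?p t)) has_real_derivative frechet_derivative f (at x) (y - x)) (at 0)"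
    using vector_derivative_diff_chain_within[of ?p "y - x" 0 UNIV f]
    by (simp add: has_real_derivative_iff_has_vector_derivative o_def has_derivative_at_withinI)
  then have "((\<lambda>t. (f (?p t) - f x) / t) \<longlongrightarrow> gradient f x \<bullet> (y - x)) (at_right 0)"
    using gradient_inner_eq_frechet_derivative[OF diff]
    by (simp add: DERIV_def filterlim_at_split)
  moreover have "(f (?p t) - f x) / t \<le> f y - f x" if "0 < t" "t < 1" for t
  proof -
    have "?p t = (1 - t) *\<^sub>R x + t *\<^sub>R y"
      by (simp add: algebra_simps)
    then have "f (?p t) \<le> (1 - t) * f x + t * f y"
      using convex_onD[OF assms(1), of t x y] that by simp
    then show ?thesis
      using that by (simp add: field_simps)
  qed
  then have "\<forall>\<^sub>F t in at_right 0. (f (?p t) - f x) / t \<le> f y - f x"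
    by (auto simp: eventually_at_right[of 0 1] intro!: exI[of _ 1])
  ultimately show ?thesis
    by (rule tendsto_upperbound) simp
qed

text \<open>The argument follows an arbitrary complete solution, not an orbit of a flow: it is
  applied to all fields of the homotopy, which are only known to be continuous.\<close>

lemma lyapunov_function_Inv:
  fixes V :: "'a::euclidean_space \<Rightarrow> real"
  assumes lyap: "lyapunov_function V G" and contG: "continuous_on UNIV G" and G0: "G 0 = 0"
    and N: "compact N" "0 \<in> N"
  shows "Inv N G = {0}"
proof
  have "is_solution G UNIV (\<lambda>_. 0)"
    by (simp add: is_solution_def G0)
  then show "{0} \<subseteq> Inv N G"
    using N by (auto simp: Inv_def intro!: exI[of _ "\<lambda>_. 0"])
next
  have V: "smooth V" "V 0 = 0" "\<And>x. x \<noteq> 0 \<Longrightarrow> V x > 0" "\<And>x. x \<noteq> 0 \<Longrightarrow> gradient V x \<bullet> G x < 0"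
    using lyap by (auto simp: lyapunov_function_def)
  have C1: "C_diff 1 V"
    using V(1) by (simp add: smooth_def)
  then have diff: "V differentiable (at x)" for x
    by (simp add: differentiable_on_def)
  then have contV: "continuous_on UNIV V"
    by (simp add: continuous_on_eq_continuous_at differentiable_imp_continuous_within)
  define D where "D x = gradient V x \<bullet> G x" for x
  have contD: "continuous_on UNIV D"
    unfolding D_def using continuous_on_gradient[OF C1] contG by (intro continuous_intros)
  have D_nonpos: "D x \<le> 0" for x
    using V(4)[of x] G0 by (cases "x = 0") (auto simp: D_def)
  show "Inv N G \<subseteq> {0}"
  proof (rule subsetI, rule ccontr)
    fix x assume "x \<in> Inv N G" and "x \<notin> {0}"
    then obtain u t0 where u: "is_solution G UNIV u" "range u \<subseteq> N" "u t0 = x" and "x \<noteq> 0"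
      by (auto simp: Inv_def)
    have "(u has_vector_derivative G (u t)) (at t)" for t
      using u(1) by (simp add: is_solution_def)
    moreover have "(V has_derivative frechet_derivative V (at x)) (at x)" for x
      using diff frechet_derivative_works by blast
    ultimately have deriv: "((\<lambda>t. V (u t)) has_real_derivative D (u t)) (at t)" for t
      using vector_derivative_diff_chain_within[of u "G (u t)" t UNIV V]
      by (simp add: has_real_derivative_iff_has_vector_derivative o_def has_derivative_at_withinI
          D_def gradient_inner_eq_frechet_derivative[OF diff])
    have above: "V x \<le> V (u t)" if "t \<le> t0" for t
      using DERIV_nonpos_imp_nonincreasing[OF that, of "\<lambda>t. V (u t)"] deriv D_nonpos u(3) by blast
    \<comment> \<open>\<open>K\<close> is compact, contains the whole past of the orbit (by
      \<open>above\<close>) and misses 0, because \<open>V 0 = 0 < V x\<close>. So the maximum of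
      \<open>D\<close> on \<open>K\<close> is negative, which gives a uniform rate of
      decrease.\<close>
    define K where "K = N \<inter> {y. V x \<le> V y}"
    have "closed {y. V x \<le> V y}"
      by (intro closed_Collect_le continuous_on_const contV)
    then have "compact K"
      unfolding K_def using N(1) by blast
    moreover have "x \<in> K"
      using u(2,3) by (auto simp: K_def)
    ultimately obtain z where z: "z \<in> K" "\<And>y. y \<in> K \<Longrightarrow> D y \<le> D z"
      using continuous_attains_sup[of K D] continuous_on_subset[OF contD] by blast
    have "z \<noteq> 0"
      using z(1) V(2) V(3)[OF \<open>x \<noteq> 0\<close>] by (auto simp: K_def)
    then have "D z < 0"
      using V(4) by (simp add: D_def)
    \<comment> \<open>The intermediate time \<open>r\<close> of the mean value theorem lies before
      \<open>t0\<close>, so \<open>u r\<close> is in \<open>K\<close> and \<open>D (u r)\<close> is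
      at most \<open>D z\<close>. The positive term \<open>V x\<close> is dropped from the lower
      bound.\<close>
    have growth: "- D z * s \<le> V (u (t0 - s))" if "s > 0" for s
    proof -
      obtain r where r: "t0 - s < r" "r < t0" "V (u t0) - V (u (t0 - s)) = (t0 - (t0 - s)) * D (u r)"
        using MVT2[of "t0 - s" t0 "\<lambda>t. V (u t)" "\<lambda>t. D (u t)"] \<open>s > 0\<close> deriv by auto
      have "u r \<in> K"
        using u(2) above[of r] r(2) by (auto simp: K_def)
      then have "s * D (u r) \<le> s * D z"
        using z(2) \<open>s > 0\<close> by simp
      then show ?thesis
        using r(3) u(3) V(3)[OF \<open>x \<noteq> 0\<close>] by (simp add: mult.commute)
    qed
    obtain B where B: "\<And>y. y \<in> N \<Longrightarrow> V y \<le> B"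
      using continuous_attains_sup[OF N(1), of V] N(2) continuous_on_subset[OF contV] by blast
    \<comment> \<open>At this time the bound \<open>growth\<close> equals
      \<open>\<bar>B\<bar> + 1\<close>, which exceeds the bound \<open>B\<close> of \<open>V\<close>
      on \<open>N\<close>. The absolute value keeps \<open>s\<close> positive whatever the sign of
      \<open>B\<close>.\<close>
    define s where "s = (\<bar>B\<bar> + 1) / - D z"
    have "s > 0"
      using \<open>D z < 0\<close> by (auto simp: s_def intro!: divide_pos_neg)
    then have "\<bar>B\<bar> + 1 \<le> V (u (t0 - s))"
      using growth[of s] \<open>D z < 0\<close> by (simp add: s_def)
    moreover have "V (u (t0 - s)) \<le> B"
      using B u(2) by blast
    ultimately show False
      by linarith
  qed
qed

lemma convex_lyapunov_function_combination:
  fixes V :: "'a::euclidean_space \<Rightarrow> real"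
  assumes lyap: "lyapunov_function V F" and conv: "convex_on UNIV V"
    and ab: "a \<ge> 0" "b \<ge> 0" "a + b > 0"
  shows "lyapunov_function V (\<lambda>x. a *\<^sub>R F x - b *\<^sub>R x)"
proof -
  have V: "smooth V" "V 0 = 0" "\<And>x. x \<noteq> 0 \<Longrightarrow> V x > 0" "\<And>x. x \<noteq> 0 \<Longrightarrow> gradient V x \<bullet> F x < 0"
    using lyap by (auto simp: lyapunov_function_def)
  have "C_diff 1 V"
    using V(1) by (simp add: smooth_def)
  then have diff: "V differentiable (at x)" for x
    by (simp add: differentiable_on_def)
  have "gradient V x \<bullet> (a *\<^sub>R F x - b *\<^sub>R x) < 0" if "x \<noteq> 0" for x
  proof -
    have x: "gradient V x \<bullet> x > 0"
      using convex_on_gradient_ineq[OF conv diff, of x 0] V(2) V(3)[OF that] by simp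
    \<comment> \<open>For \<open>a = 0\<close> the strict sign comes from \<open>-x\<close> alone,
      as \<open>a + b > 0\<close> forces \<open>b > 0\<close>. Otherwise it comes from
      \<open>F\<close>, and the term in \<open>-x\<close> need only be nonpositive.\<close>
    show ?thesis
    proof (cases "a = 0")
      case True
      then show ?thesis using ab x by (simp add: inner_diff_right)
    next
      case False
      then have "a * (gradient V x \<bullet> F x) < 0" "b * (gradient V x \<bullet> x) \<ge> 0"
        using ab x V(4)[OF that] by (simp_all add: mult_pos_neg)
      then show ?thesis by (simp add: inner_diff_right)
    qed
  qed
  then show ?thesis
    using lyap by (simp add: lyapunov_function_def)
qed

lemma compact_sublevel:
  fixes V :: "'a::euclidean_space \<Rightarrow> real"
  assumes "continuous_on UNIV V" and "filterlim V at_top at_infinity"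
  shows "compact {x. V x \<le> c}"
proof -
  have "\<forall>\<^sub>F x in at_infinity. c < V x"
    using assms(2) by (simp add: filterlim_at_top_dense)
  then obtain B where "\<And>x. norm x \<ge> B \<Longrightarrow> c < V x"
    by (auto simp: eventually_at_infinity)
  then have "norm x \<le> B" if "V x \<le> c" for x
    using that by (metis linorder_not_le linorder_le_cases)
  then have "bounded {x. V x \<le> c}"
    by (auto simp: bounded_iff)
  then show ?thesis
    using closed_Collect_le[OF assms(1) continuous_on_const] by (simp add: compact_eq_bounded_closed)
qed

theorem mainTheorem6:
  fixes F0 F1 :: "real ^ 'n \<Rightarrow> real ^ 'n"
    and \<phi>0 \<phi>1 :: "real \<Rightarrow> real ^ 'n \<Rightarrow> real ^ 'n"
    and V0 V1 :: "real ^ 'n \<Rightarrow> real"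
  assumes "continuous_on UNIV F0" and "continuous_on UNIV F1"
    and "induces_flow F0 \<phi>0" and "induces_flow F1 \<phi>1"
    and "GAS F0 \<phi>0" and "GAS F1 \<phi>1"
    and "lyapunov_function V0 F0" and "lyapunov_function V1 F1"
    and "convex_on UNIV V0" and "convex_on UNIV V1"
  shows "\<exists>c0 > 0. \<exists>c1 > 0. related_by_continuation F0 F1 ({x. V0 x \<le> c0} \<inter> {x. V1 x \<le> c1})"
proof -
  \<comment> \<open>The level 1 is arbitrary: any positive levels give a compact set with 0 in its
    interior.\<close>
  define N where "N = {x. V0 x \<le> 1} \<inter> {x. V1 x \<le> 1}"
  have zero: "F0 0 = 0" "F1 0 = 0" "V0 0 = 0" "V1 0 = 0"
    using assms(5-8) by (auto simp: GAS_def lyapunov_function_def)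
  have "C_diff 0 V0" "C_diff 0 V1"
    using assms(7,8) unfolding lyapunov_function_def smooth_def by blast+
  then have cont: "continuous_on UNIV V0" "continuous_on UNIV V1"
    by simp_all
  have "compact N"
    unfolding N_def using assms(7,8) cont
    by (intro compact_Int compact_sublevel) (auto simp: lyapunov_function_def)
  have "open ({x. V0 x < 1} \<inter> {x. V1 x < 1})"
    by (intro open_Int open_Collect_less cont continuous_on_const)
  moreover have "{x. V0 x < 1} \<inter> {x. V1 x < 1} \<subseteq> N"
    by (auto simp: N_def)
  moreover have "0 \<in> {x. V0 x < 1} \<inter> {x. V1 x < 1}"
    using zero by simp
  ultimately have "0 \<in> interior N"
    using interiorI by blast
  then have "0 \<in> N"
    using interior_subset by blast
  \<comment> \<open>Both segments in one formula, so that continuity needs no gluing. The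
    coefficients of \<open>F0 x\<close>, \<open>F1 x\<close> and \<open>-x\<close> are
    \<open>1 - 2 * s\<close>, 0, \<open>2 * s\<close> for \<open>s\<close> up to 1/2, and 0,
    \<open>2 * s - 1\<close>, \<open>2 - 2 * s\<close> from there on. At the midpoint the field is
    \<open>-x\<close>.\<close>
  define H where
    "H s x = max 0 (1 - 2 * s) *\<^sub>R F0 x + max 0 (2 * s - 1) *\<^sub>R F1 x - (1 - \<bar>1 - 2 * s\<bar>) *\<^sub>R x"
    for s :: real and x
  have contH: "continuous_on ({0..1} \<times> UNIV) (\<lambda>(s, x). H s x)"
    unfolding H_def case_prod_beta
    by (intro continuous_intros continuous_on_compose2[OF assms(1)]
        continuous_on_compose2[OF assms(2)]) auto
  have H01: "H 0 = F0" "H 1 = F1"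
    by (auto simp: H_def)
  have Inv_H: "Inv N (H s) = {0}" if s: "s \<in> {0..1}" for s
  proof -
    \<comment> \<open>Either function suffices for the same \<open>N\<close>, since
      \<open>lyapunov_function_Inv\<close> asks only for a compact set containing 0, not for a
      sublevel set of the function in use.\<close>
    have "lyapunov_function V0 (H s) \<or> lyapunov_function V1 (H s)"
    proof (cases "s \<le> 1 / 2")
      case True
      then have "H s = (\<lambda>x. (1 - 2 * s) *\<^sub>R F0 x - (2 * s) *\<^sub>R x)"
        by (auto simp: H_def max_def)
      then show ?thesis
        using convex_lyapunov_function_combination[OF assms(7,9), of "1 - 2 * s" "2 * s"] True s
        by simp
    next
      case False
      then have "H s = (\<lambda>x. (2 * s - 1) *\<^sub>R F1 x - (2 - 2 * s) *\<^sub>R x)"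
        by (auto simp: H_def max_def)
      then show ?thesis
        using convex_lyapunov_function_combination[OF assms(8,10), of "2 * s - 1" "2 - 2 * s"] False s
        by simp
    qed
    moreover have "continuous_on UNIV (H s)"
      unfolding H_def by (intro continuous_intros assms(1,2))
    moreover have "H s 0 = 0"
      using zero by (simp add: H_def)
    ultimately show ?thesis
      using lyapunov_function_Inv \<open>compact N\<close> \<open>0 \<in> N\<close> by blast
  qed
  have "isolating_neighbourhood N (H s)" if "s \<in> {0..1}" for s
    using Inv_H[OF that] \<open>compact N\<close> \<open>0 \<in> interior N\<close> by (simp add: isolating_neighbourhood_def)
  moreover have "Inv N F0 = {0}" "Inv N F1 = {0}"
    using Inv_H[of 0] Inv_H[of 1] H01 by auto
  ultimately have "related_by_continuation F0 F1 N"
    unfolding related_by_continuation_def using contH H01 by blast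
  then show ?thesis
    unfolding N_def using zero_less_one by blast
qed

end
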